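(* Let $\nu,N,m,\ell,n\in\mathbb{N}$, let $\mathbb{P}\subseteq\mathbb{C}^\nu$ be a compact set, and let $E,A\colon\mathbb{P}\to\mathbb{C}^{N\times N}$, $B\colon\mathbb{P}\to\mathbb{C}^{N\times m}$, $C\colon\mathbb{P}\to\mathbb{C}^{\ell\times N}$ be holomorphic in $\mathbb{P}$, with $E(p)$ nonsingular for every $p\in\mathbb{P}$. For $i=1,\ldots,n$ let $\lambda_i,\mu_i\colon\mathbb{P}\to\mathbb{C}$, $r_i\colon\mathbb{P}\to\mathbb{C}^m$, $\ell_i\colon\mathbb{P}\to\mathbb{C}^\ell$ be holomorphic with $\lambda_i(p),\mu_i(p)\notin\sigma(E(p),A(p))$ for all $p\in\mathbb{P}$. Let $V,W\colon\mathbb{P}\to\mathbb{C}^{N\times n}$ be holomorphic functions satisfying $$A(p)V(p)-E(p)V(p)\Lambda(p)+B(p)R(p)=0,$$ $$W(p)^\top A(p)-M(p)^\top W(p)^\top E(p)+L(p)^\top C(p)=0$$ for all $p\in\mathbb{P}$, and construct the reduced-order model by $$\widehat E(p)=W(p)^\top E(p)V(p),\quad \widehat A(p)=W(p)^\top A(p)V(p),\quad \widehat B(p)=W(p)^\top B(p),\quad \widehat C(p)=C(p)V(p).$$ Then the reduced-order model satisfies, for all $p\in\mathbb{P}$ and all $i=1,\ldots,n$, the interpolation conditions $$H(\lambda_i(p);p)\,r_i(p)=\widehat H(\lambda_i(p);p)\,r_i(p)\quad\text{and}\quad \ell_i(p)^\top H(\mu_i(p);p)=\ell_i(p)^\top\widehat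 H(\mu_i(p);p),$$ where $H$ and $\widehat H$ are the transfer functions of the full-order and the reduced-order model. It thus solves the problem of constructing a reduced-order model whose transfer function tangentially interpolates $H$, for all parameters $p\in\mathbb{P}$, at the parameter-dependent frequencies $\lambda_i$ along the right tangent directions $r_i$ and at the parameter-dependent frequencies $\mu_i$ along the left tangent directions $\ell_i$.
   Context: The full-order model is the parametric system $E(p)\dot x(t;p)=A(p)x(t;p)+B(p)u(t)$, $y(t;p)=C(p)x(t;p)$, $x(0;p)=0$, with transfer function $$H(s;p)=C(p)\bigl(sE(p)-A(p)\bigr)^{-1}B(p),$$ and the reduced-order model is the system of the same form with matrices $\widehat E,\widehat A,\widehat B,\widehat C$, with transfer function $$\widehat H(s;p)=\widehat C(p)\bigl(s\widehat E(p)-\widehat A(p)\bigr)^{-1}\widehat B(p).$$ The spectrum of the matrix pencil $sE(p)-A(p)$ is $\sigma(E(p),A(p))=\{s\in\mathbb{C}\mid \operatorname{rank}(sE(p)-A(p))<N\}$. The matrix functions $\Lambda,M\colon\mathbb{P}\to\mathbb{C}^{n\times n}$, $R\colon\mathbb{P}\to\mathbb{C}^{m\times n}$, $L\colon\mathbb{P}\to\mathbb{C}^{\ell\times n}$ are defined by $$\Lambda(p)=\operatorname{diag}(\lambda_1(p),\ldots,\lambda_n(p)),\quad M(p)=\operatorname{diag}(\mu_1(p),\ldots,\mu_n(p)),$$ $$R(p)=\begin{bmatrix} r_1(p)&\cdots&r_n(p)\end{bmatrix},\quad L(p)=\begin{bmatrix}\ell_1(p)&\cdots&\ell_n(p)\end{bmatrix}.$$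 The superscript $\top$ is the plain transpose (no complex conjugation). A scalar function of several complex variables is holomorphic at $p$ if $\lim_{h\to0}(f(p+hq)-f(p))/h$ (with $h\in\mathbb{C}$) exists for every $q\in\mathbb{C}^\nu$; vector- and matrix-valued functions are holomorphic if all entries are. A function on the compact set $\mathbb{P}$ is called holomorphic in $\mathbb{P}$ if it is the restriction to $\mathbb{P}$ of a function holomorphic on an open neighborhood of $\mathbb{P}$ in $\mathbb{C}^\nu$.
   Formalization: Each interpolation condition is asserted only when its frequency λ_i(p), respectively μ_i(p), is not in the spectrum of the reduced pencil sÊ(p)−Â(p), since otherwise Ĥ is undefined there and the claim can fail. *)

theory Defs
  imports "HOL-Analysis.Analysis"
begin

text \<open>
  Holomorphy in several variables: existence of all complex directional derivatives. No linearity
  in the direction is demanded.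
\<close>

definition mv_holomorphic_at :: "(complex ^ 'v \<Rightarrow> complex) \<Rightarrow> complex ^ 'v \<Rightarrow> bool"
  where "mv_holomorphic_at f p \<longleftrightarrow>
    (\<forall>q. \<exists>d. ((\<lambda>h. (f (p + h *s q) - f p) / h) \<longlongrightarrow> d) (at 0))"

text \<open>
  Functions on a set \<open>P\<close> are total functions whose values outside \<open>P\<close> are irrelevant.
\<close>

definition mv_holomorphic_in :: "(complex ^ 'v) set \<Rightarrow> (complex ^ 'v \<Rightarrow> complex) \<Rightarrow> bool"
  where "mv_holomorphic_in P f \<longleftrightarrow>
    (\<exists>U g. open U \<and> P \<subseteq> U \<and> (\<forall>p\<in>U. mv_holomorphic_at g p) \<and> (\<forall>p\<in>P. g p = f p))"

definition mv_holomorphic_vec_in :: "(complex ^ 'v) set \<Rightarrow> (complex ^ 'v \<Rightarrow> complex ^ 'a) \<Rightarrow> bool"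
  where "mv_holomorphic_vec_in P f \<longleftrightarrow> (\<forall>i. mv_holomorphic_in P (\<lambda>p. f p $ i))"

definition mv_holomorphic_mat_in ::
    "(complex ^ 'v) set \<Rightarrow> (complex ^ 'v \<Rightarrow> complex ^ 'b ^ 'a) \<Rightarrow> bool"
  where "mv_holomorphic_mat_in P F \<longleftrightarrow> (\<forall>i j. mv_holomorphic_in P (\<lambda>p. F p $ i $ j))"

text \<open>
  The matrix \<open>s E - A\<close>; \<open>mat s\<close> is the scalar matrix with diagonal entry \<open>s\<close>.
\<close>

definition pencil :: "complex ^ 'N ^ 'N \<Rightarrow> complex ^ 'N ^ 'N \<Rightarrow> complex \<Rightarrow> complex ^ 'N ^ 'N"
  where "pencil E A s = mat s ** E - A"

definition pencil_spectrum :: "complex ^ 'N ^ 'N \<Rightarrow> complex ^ 'N ^ 'N \<Rightarrow> complex set"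
  where "pencil_spectrum E A = {s. rank (pencil E A s) < CARD('N)}"

text \<open>
  Meaningful only for \<open>s\<close> outside \<open>pencil_spectrum (E p) (A p)\<close>: \<^const>\<open>matrix_inv\<close> of a singular
  matrix is an unspecified value.
\<close>

definition transfer_function ::
    "('p \<Rightarrow> complex ^ 'N ^ 'N) \<Rightarrow> ('p \<Rightarrow> complex ^ 'N ^ 'N) \<Rightarrow>
     ('p \<Rightarrow> complex ^ 'm ^ 'N) \<Rightarrow> ('p \<Rightarrow> complex ^ 'N ^ 'l) \<Rightarrow>
     complex \<Rightarrow> 'p \<Rightarrow> complex ^ 'm ^ 'l"
  where "transfer_function E A B C s p = C p ** matrix_inv (pencil (E p) (A p) s) ** B p"

definition diag_matrix :: "('n \<Rightarrow> complex) \<Rightarrow> complex ^ 'n ^ 'n"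
  where "diag_matrix d = (\<chi> i j. if i = j then d i else 0)"

definition matrix_of_columns :: "('n \<Rightarrow> complex ^ 'a) \<Rightarrow> complex ^ 'n ^ 'a"
  where "matrix_of_columns c = (\<chi> a i. c i $ a)"

end

theory Submission
  imports Defs
begin

text \<open>
  Fix a parameter \<open>p\<close>, write \<open>K = s E - A\<close> and \<open>U = W\<^sup>T\<close>. The reduced pencil is \<open>U K V\<close>, so
  the two transfer functions are \<open>C K\<^sup>-\<^sup>1 B\<close> and \<open>C (V (U K V)\<^sup>-\<^sup>1 U) B\<close>, where \<open>K\<close> and \<open>U K V\<close>
  are invertible because \<open>s\<close> lies in neither spectrum. It therefore suffices to compare \<open>K\<^sup>-\<^sup>1\<close>
  with \<open>V (U K V)\<^sup>-\<^sup>1 U\<close>. The latter inverts \<open>K\<close> correctly on every vector \<open>K V e\<close>, returning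
  \<open>V e\<close>, and, acting on rows from the right, on every row \<open>e\<^sup>T U K\<close>, returning \<open>e\<^sup>T U\<close>
  (\<open>petrov_galerkin_exact_right\<close> and \<open>petrov_galerkin_exact_left\<close>).

  The Sylvester equations put the tangential data into this position: column \<open>i\<close> of the first
  reads \<open>K V e\<^sub>i = B r\<^sub>i\<close> at \<open>s = \<lambda>\<^sub>i\<close> (\<open>sylvester_column\<close>), and row \<open>i\<close> of the second reads
  \<open>e\<^sub>i\<^sup>T U K = \<ell>\<^sub>i\<^sup>T C\<close> at \<open>s = \<mu>\<^sub>i\<close> (\<open>sylvester_row\<close>).
\<close>

lemma rank_full_imp_invertible:
  fixes K :: "'a::field ^ 'n ^ 'n"
  assumes "\<not> rank K < CARD('n)"
  shows "invertible K"
proof -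
  have "vec.dim (rows K) \<le> CARD('n)"
    using vec.dim_subset_UNIV [of "rows K"] by (simp add: vec.dimension_def card_cart_basis)
  then have "vec.dim (rows K) = CARD('n)"
    using assms by (simp add: row_rank_def_gen)
  then have "vec.span (rows K) = UNIV"
    by (simp add: vec.dimension_def card_cart_basis flip: vec.dim_eq_full)
  then show ?thesis
    by (simp add: invertible_left_inverse matrix_left_invertible_span_rows_gen)
qed

lemma notin_pencil_spectrum_imp_invertible:
  assumes "s \<notin> pencil_spectrum E A"
  shows "invertible (pencil E A s)"
  using assms by (intro rank_full_imp_invertible) (simp add: pencil_spectrum_def)

lemma matrix_inv_inverse:
  fixes K :: "'a::semiring_1 ^ 'n ^ 'm"
  assumes "invertible K"
  shows "K ** matrix_inv K = mat 1" "matrix_inv K ** K = mat 1"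
  using someI_ex[OF assms[unfolded invertible_def]] by (simp_all add: matrix_inv_def)

lemma mat_mult_vector: "mat s *v x = s *s (x :: 'a::semiring_1 ^ 'n)"
  by (simp add: vec_eq_iff mat_def matrix_vector_mult_def if_distrib [where f = "\<lambda>c. c * _"]
      cong: if_cong)

lemma vector_mult_mat: "x v* mat s = s *s (x :: 'a::comm_semiring_1 ^ 'n)"
  by (simp add: vec_eq_iff mat_def vector_matrix_mult_def if_distrib mult.commute cong: if_cong)

lemma diag_matrix_mult_axis: "diag_matrix d *v axis i 1 = d i *s axis i 1"
  by (simp add: vec_eq_iff diag_matrix_def matrix_vector_mult_def axis_def
      if_distrib [where f = "\<lambda>c. _ * c"] cong: if_cong)

lemma transpose_diag_matrix [simp]: "transpose (diag_matrix d) = diag_matrix d"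
  by (auto simp: vec_eq_iff transpose_def diag_matrix_def)

lemma axis_mult_diag_matrix: "axis i 1 v* diag_matrix d = d i *s axis i 1"
  by (metis diag_matrix_mult_axis transpose_diag_matrix transpose_matrix_vector)

lemma matrix_of_columns_mult_axis: "matrix_of_columns c *v axis i 1 = c i"
  by (simp add: vec_eq_iff matrix_of_columns_def matrix_vector_mult_def axis_def
      if_distrib [where f = "\<lambda>c. _ * c"] cong: if_cong)

lemma pencil_mult_vector: "pencil E A s *v x = s *s (E *v x) - A *v x"
  by (simp add: pencil_def matrix_vector_mult_diff_rdistrib mat_mult_vector
      flip: matrix_vector_mul_assoc)

lemma vector_mult_pencil: "x v* pencil E A s = s *s (x v* E) - x v* A"
  by (simp add: pencil_def vector_matrix_mult_diff_rdistrib vector_mult_mat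
      scalar_vector_matrix_assoc flip: vector_matrix_mul_assoc)

lemma pencil_project:
  "pencil (U ** E ** V) (U ** A ** V) s = U ** pencil E A s ** V"
  by (simp add: matrix_eq pencil_mult_vector matrix_vector_mult_diff_distrib
      vec.scale flip: matrix_vector_mul_assoc)

text \<open>
  Because the coefficient is diagonal, the matrix equation decouples: applied to the unit vector
  \<open>e\<^sub>i\<close>, it involves only the entry \<open>d i\<close> and the column \<open>r i\<close>. In the dual equation, the rows
  decouple in the same way.
\<close>

lemma sylvester_column:
  assumes "A ** V - E ** V ** diag_matrix d + B ** matrix_of_columns r = 0"
  shows "pencil E A (d i) *v (V *v axis i 1) = B *v r i"
proof -
  have "(A ** V - E ** V ** diag_matrix d + B ** matrix_of_columns r) *v axis i 1 = 0"
    using assms by simp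
  then have "A *v (V *v axis i 1) - d i *s (E *v (V *v axis i 1)) + B *v r i = 0"
    by (simp add: matrix_vector_mult_add_rdistrib matrix_vector_mult_diff_rdistrib
        diag_matrix_mult_axis matrix_of_columns_mult_axis vec.scale
        flip: matrix_vector_mul_assoc)
  then show ?thesis
    by (simp add: pencil_mult_vector algebra_simps add_eq_0_iff)
qed

lemma sylvester_row:
  assumes "U ** A - transpose (diag_matrix d) ** U ** E + transpose (matrix_of_columns l) ** C = 0"
  shows "(axis i 1 v* U) v* pencil E A (d i) = l i v* C"
proof -
  have "axis i 1 v* (U ** A - transpose (diag_matrix d) ** U ** E
      + transpose (matrix_of_columns l) ** C) = 0"
    using assms by simp
  then have "(axis i 1 v* U) v* A - d i *s ((axis i 1 v* U) v* E) + l i v* C = 0"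
    by (simp add: vector_matrix_mult_add_rdistrib vector_matrix_mult_diff_rdistrib
        axis_mult_diag_matrix matrix_of_columns_mult_axis scalar_vector_matrix_assoc
        flip: vector_matrix_mul_assoc)
  then show ?thesis
    by (simp add: vector_mult_pencil algebra_simps add_eq_0_iff)
qed

text \<open>
  Galerkin approximation of \<open>K x = b\<close> in the range of \<open>V\<close> is exact whenever the solution already
  lies in that range; dually, the row equation \<open>x\<^sup>T K = c\<^sup>T\<close> is solved exactly whenever \<open>x\<^sup>T\<close>
  lies in the row space of \<open>U\<close>.
\<close>

lemma petrov_galerkin_exact_right:
  fixes K :: "'a::field ^ 'N ^ 'N" and U :: "'a ^ 'N ^ 'n" and V :: "'a ^ 'n ^ 'N"
  assumes "invertible K" "invertible (U ** K ** V)" and b: "K *v (V *v e) = b"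
  shows "V *v (matrix_inv (U ** K ** V) *v (U *v b)) = matrix_inv K *v b"
proof -
  have "matrix_inv K *v b = V *v e"
    by (simp only: b [symmetric] matrix_vector_mul_assoc [of "matrix_inv K" K]
        matrix_inv_inverse(2) [OF assms(1)] matrix_vector_mul_lid)
  moreover have "U *v b = (U ** K ** V) *v e"
    by (simp add: b [symmetric] flip: matrix_vector_mul_assoc)
  then have "matrix_inv (U ** K ** V) *v (U *v b) = e"
    by (simp only: matrix_vector_mul_assoc matrix_inv_inverse(2) [OF assms(2)]
        matrix_vector_mul_lid)
  ultimately show ?thesis by simp
qed

lemma petrov_galerkin_exact_left:
  fixes K :: "'a::field ^ 'N ^ 'N" and U :: "'a ^ 'N ^ 'n" and V :: "'a ^ 'n ^ 'N"
  assumes "invertible K" "invertible (U ** K ** V)" and c: "(e v* U) v* K = c"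
  shows "((c v* V) v* matrix_inv (U ** K ** V)) v* U = c v* matrix_inv K"
proof -
  have "c v* matrix_inv K = e v* U"
    by (simp only: c [symmetric] vector_matrix_mul_assoc
        matrix_mul_assoc [symmetric] matrix_inv_inverse(1) [OF assms(1)] matrix_mul_rid)
  moreover have "c v* V = e v* (U ** K ** V)"
    by (simp add: c [symmetric] flip: vector_matrix_mul_assoc)
  then have "(c v* V) v* matrix_inv (U ** K ** V) = e"
    by (simp only: vector_matrix_mul_assoc matrix_inv_inverse(1) [OF assms(2)]
        vector_matrix_mul_rid)
  ultimately show ?thesis by simp
qed

theorem corollary3p2:
  fixes P :: "(complex ^ 'v) set"
    and E A :: "complex ^ 'v \<Rightarrow> complex ^ 'N ^ 'N"
    and B :: "complex ^ 'v \<Rightarrow> complex ^ 'm ^ 'N"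
    and C :: "complex ^ 'v \<Rightarrow> complex ^ 'N ^ 'l"
    and lam mu :: "'n::finite \<Rightarrow> complex ^ 'v \<Rightarrow> complex"
    and r :: "'n \<Rightarrow> complex ^ 'v \<Rightarrow> complex ^ 'm"
    and lt :: "'n \<Rightarrow> complex ^ 'v \<Rightarrow> complex ^ 'l"
    and Lam M :: "complex ^ 'v \<Rightarrow> complex ^ 'n ^ 'n"
    and R :: "complex ^ 'v \<Rightarrow> complex ^ 'n ^ 'm"
    and L :: "complex ^ 'v \<Rightarrow> complex ^ 'n ^ 'l"
    and V W :: "complex ^ 'v \<Rightarrow> complex ^ 'n ^ 'N"
    and E' A' :: "complex ^ 'v \<Rightarrow> complex ^ 'n ^ 'n"
    and B' :: "complex ^ 'v \<Rightarrow> complex ^ 'm ^ 'n"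
    and C' :: "complex ^ 'v \<Rightarrow> complex ^ 'n ^ 'l"
  assumes "compact P"
    and "mv_holomorphic_mat_in P E" and "mv_holomorphic_mat_in P A"
    and "mv_holomorphic_mat_in P B" and "mv_holomorphic_mat_in P C"
    and "\<And>p. p \<in> P \<Longrightarrow> invertible (E p)"
    and "\<And>i. mv_holomorphic_in P (lam i)" and "\<And>i. mv_holomorphic_in P (mu i)"
    and "\<And>i. mv_holomorphic_vec_in P (r i)" and "\<And>i. mv_holomorphic_vec_in P (lt i)"
    and "\<And>i p. p \<in> P \<Longrightarrow> lam i p \<notin> pencil_spectrum (E p) (A p)"
    and "\<And>i p. p \<in> P \<Longrightarrow> mu i p \<notin> pencil_spectrum (E p) (A p)"
    and "\<And>p. p \<in> P \<Longrightarrow> Lam p = diag_matrix (\<lambda>i. lam i p)"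
    and "\<And>p. p \<in> P \<Longrightarrow> M p = diag_matrix (\<lambda>i. mu i p)"
    and "\<And>p. p \<in> P \<Longrightarrow> R p = matrix_of_columns (\<lambda>i. r i p)"
    and "\<And>p. p \<in> P \<Longrightarrow> L p = matrix_of_columns (\<lambda>i. lt i p)"
    and "mv_holomorphic_mat_in P V" and "mv_holomorphic_mat_in P W"
    and "\<And>p. p \<in> P \<Longrightarrow> A p ** V p - E p ** V p ** Lam p + B p ** R p = 0"
    and "\<And>p. p \<in> P \<Longrightarrow>
      transpose (W p) ** A p - transpose (M p) ** transpose (W p) ** E p
        + transpose (L p) ** C p = 0"
    and "\<And>p. p \<in> P \<Longrightarrow> E' p = transpose (W p) ** E p ** V p"
    and "\<And>p. p \<in> P \<Longrightarrow> A' p = transpose (W p) ** A p ** V p"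
    and "\<And>p. p \<in> P \<Longrightarrow> B' p = transpose (W p) ** B p"
    and "\<And>p. p \<in> P \<Longrightarrow> C' p = C p ** V p"
  shows "\<forall>p\<in>P. \<forall>i.
    (lam i p \<notin> pencil_spectrum (E' p) (A' p) \<longrightarrow>
      transfer_function E A B C (lam i p) p *v r i p
        = transfer_function E' A' B' C' (lam i p) p *v r i p) \<and>
    (mu i p \<notin> pencil_spectrum (E' p) (A' p) \<longrightarrow>
      lt i p v* transfer_function E A B C (mu i p) p
        = lt i p v* transfer_function E' A' B' C' (mu i p) p)"
proof (intro ballI allI conjI impI)
  fix p i
  assume p: "p \<in> P"
  define U where "U = transpose (W p)"
  have sylv_V: "A p ** V p - E p ** V p ** diag_matrix (\<lambda>i. lam i p)
      + B p ** matrix_of_columns (\<lambda>i. r i p) = 0"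
    using assms(19) [OF p] by (simp add: assms(13,15) [OF p])
  have sylv_W: "U ** A p - transpose (diag_matrix (\<lambda>i. mu i p)) ** U ** E p
      + transpose (matrix_of_columns (\<lambda>i. lt i p)) ** C p = 0"
    using assms(20) [OF p] by (simp only: U_def assms(14,16) [OF p])
  note rom = assms(21-24) [OF p, folded U_def]
  have pencil': "pencil (E' p) (A' p) s = U ** pencil (E p) (A p) s ** V p" for s
    by (simp add: rom pencil_project)

  show "transfer_function E A B C (lam i p) p *v r i p
      = transfer_function E' A' B' C' (lam i p) p *v r i p"
    if "lam i p \<notin> pencil_spectrum (E' p) (A' p)"
  proof -
    have "invertible (pencil (E p) (A p) (lam i p))"
      using assms(11) [OF p] by (rule notin_pencil_spectrum_imp_invertible)
    moreover have "invertible (U ** pencil (E p) (A p) (lam i p) ** V p)"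
      using notin_pencil_spectrum_imp_invertible [OF that] by (simp add: pencil')
    ultimately have "V p *v (matrix_inv (U ** pencil (E p) (A p) (lam i p) ** V p)
          *v (U *v (B p *v r i p)))
        = matrix_inv (pencil (E p) (A p) (lam i p)) *v (B p *v r i p)"
      using sylvester_column [OF sylv_V] by (rule petrov_galerkin_exact_right)
    then show ?thesis
      by (simp add: transfer_function_def pencil' rom(3,4) flip: matrix_vector_mul_assoc)
  qed

  show "lt i p v* transfer_function E A B C (mu i p) p
      = lt i p v* transfer_function E' A' B' C' (mu i p) p"
    if "mu i p \<notin> pencil_spectrum (E' p) (A' p)"
  proof -
    have "invertible (pencil (E p) (A p) (mu i p))"
      using assms(12) [OF p] by (rule notin_pencil_spectrum_imp_invertible)
    moreover have "invertible (U ** pencil (E p) (A p) (mu i p) ** V p)"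
      using notin_pencil_spectrum_imp_invertible [OF that] by (simp add: pencil')
    ultimately have "(((lt i p v* C p) v* V p)
          v* matrix_inv (U ** pencil (E p) (A p) (mu i p) ** V p)) v* U
        = (lt i p v* C p) v* matrix_inv (pencil (E p) (A p) (mu i p))"
      using sylvester_row [OF sylv_W] by (rule petrov_galerkin_exact_left)
    then show ?thesis
      by (simp add: transfer_function_def pencil' rom(3,4) flip: vector_matrix_mul_assoc)
  qed
qed

end
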